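(* Let $p$ be an integer and let $q$ and $n$ be positive integers with $n \geq q^2$. Then the function $f_n : \mathbb{R} \to \mathbb{R}$ given by $$f_n(x) = \sum_{k=1}^{n} \frac{|\sin(k\pi x)|}{k}$$ has a strict local minimum at $x = p/q$.
   Context: A function $f:\mathbb{R}\to\mathbb{R}$ has a strict local minimum at $x_0$ if there is $\delta>0$ such that $f(x) > f(x_0)$ for all $x$ with $0<|x-x_0|<\delta$. *)

theory Defs
  imports Complex_Main
begin

definition strict_local_min :: "(real \<Rightarrow> real) \<Rightarrow> real \<Rightarrow> bool" where
  "strict_local_min f x0 \<longleftrightarrow>
     (\<exists>\<delta>>0. \<forall>x. 0 < \<bar>x - x0\<bar> \<and> \<bar>x - x0\<bar> < \<delta> \<longrightarrow> f x > f x0)"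

definition abs_sin_sum :: "nat \<Rightarrow> real \<Rightarrow> real" where
  "abs_sin_sum n x = (\<Sum>k=1..n. \<bar>sin (real k * pi * x)\<bar> / real k)"

end

theory Submission
  imports Defs
begin

text \<open>
  Every summand has a one-sided derivative at \<open>p/q\<close>. The at least \<open>n div q \<ge> q\<close> summands with
  \<open>q dvd k\<close> vanish there and contribute \<open>pi\<close> each to the right derivative. The other summands
  contribute \<open>pi * cos t * sgn (sin t)\<close> with \<open>t = k * pi * p / q\<close>; these numbers cancel over each
  full period of length \<open>q\<close> by the symmetry \<open>k \<mapsto> q - k\<close>, so only the last
  \<open>n mod q \<le> q - 1\<close> of them matter, each at least \<open>-pi\<close>. Hence the right derivative is positive,
  and evenness of the sum transfers the conclusion to the left side.
\<close>

lemma abs_sin_int_shift: "\<bar>sin (x + of_int m * pi)\<bar> = \<bar>sin (x::real)\<bar>"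
proof -
  have "sin (of_int m * pi) = 0"
    using sin_zero_iff_int2 by blast
  with sin_zero_abs_cos_one[of "of_int m * pi"] show ?thesis
    by (simp add: sin_add abs_mult)
qed

text \<open>The case split is needed because \<open>sgn 0 = 0\<close>: at a zero of
  \<open>sin\<close> the product would give 0, whereas the right branch of the corner has slope
  1.\<close>

definition abs_sin_right_slope :: "real \<Rightarrow> real" where
  "abs_sin_right_slope t = (if sin t = 0 then 1 else cos t * sgn (sin t))"

text \<open>To the right of a zero \<open>t\<close>, up to distance \<open>pi\<close>, the function
  agrees with \<open>sin (x - t)\<close>. Elsewhere \<open>sin\<close> keeps its sign near
  \<open>t\<close>, so the function is locally \<open>sin\<close> times a constant sign.\<close>

lemma has_right_derivative_abs_sin:
  "((\<lambda>x. \<bar>sin x\<bar>) has_real_derivative abs_sin_right_slope t) (at t within {t..})"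
proof (cases "sin t = 0")
  case True
  then obtain m :: int where m: "t = of_int m * pi"
    using sin_zero_iff_int2 by blast
  have "((\<lambda>x. sin (x - t)) has_real_derivative 1) (at t within {t..})"
    by (auto intro!: derivative_eq_intros)
  moreover have "sin (x - t) = \<bar>sin x\<bar>" if "x \<in> {t..}" "dist x t < pi" for x
  proof -
    have "sin (x - t) \<ge> 0"
      using that by (intro sin_ge_zero) (auto simp: dist_real_def)
    then show ?thesis
      using abs_sin_int_shift[of "x - t" m] m by simp
  qed
  ultimately show ?thesis
    using True by (auto simp: abs_sin_right_slope_def
        intro: has_field_derivative_transform_within[where d = pi])
next
  case False
  have "isCont (\<lambda>x. sgn (sin t) * sin x) t"
    by (intro continuous_intros)
  moreover have "0 < sgn (sin t) * sin t"
    using False by (simp add: sgn_if)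
  ultimately have "eventually (\<lambda>x. 0 < sgn (sin t) * sin x) (at t)"
    unfolding isCont_def by (rule order_tendstoD(1))
  then obtain d where d: "d > 0" "\<And>x. x \<noteq> t \<Longrightarrow> dist x t < d \<Longrightarrow> 0 < sgn (sin t) * sin x"
    unfolding eventually_at by blast
  have "((\<lambda>x. sgn (sin t) * sin x) has_real_derivative sgn (sin t) * cos t) (at t within {t..})"
    by (auto intro!: derivative_eq_intros)
  moreover have "sgn (sin t) * sin x = \<bar>sin x\<bar>" if "dist x t < d" for x
    using d(2)[of x] that False by (cases "x = t") (auto simp: sgn_if abs_if split: if_splits)
  ultimately have "((\<lambda>x. \<bar>sin x\<bar>) has_real_derivative sgn (sin t) * cos t) (at t within {t..})"
    using d(1) by (auto intro: has_field_derivative_transform_within[where d = d])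
  then show ?thesis
    using False by (simp add: abs_sin_right_slope_def mult.commute)
qed

text \<open>The chain-rule factor \<open>real k * pi\<close> cancels the weight
  \<open>1 / k\<close>, so all slopes enter equally.\<close>

lemma has_right_derivative_abs_sin_sum:
  "(abs_sin_sum n has_real_derivative
      pi * (\<Sum>k=1..n. abs_sin_right_slope (real k * pi * x0))) (at x0 within {x0..})"
proof -
  have "((\<lambda>x. \<bar>sin (real k * pi * x)\<bar> / real k) has_real_derivative
      pi * abs_sin_right_slope (real k * pi * x0)) (at x0 within {x0..})"
    if "k \<in> {1..n}" for k
  proof -
    \<comment> \<open>Scaling by a nonnegative factor keeps right neighbourhoods on the right, so
      one-sided derivatives compose.\<close>
    have "(\<lambda>x. real k * pi * x) ` {x0..} \<subseteq> {real k * pi * x0..}"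
      by (auto intro: mult_left_mono)
    then have "((\<lambda>x. \<bar>sin x\<bar>) has_real_derivative abs_sin_right_slope (real k * pi * x0))
        (at (real k * pi * x0) within (\<lambda>x. real k * pi * x) ` {x0..})"
      using has_right_derivative_abs_sin has_field_derivative_subset by blast
    moreover have "((\<lambda>x. real k * pi * x) has_real_derivative real k * pi) (at x0 within {x0..})"
      by (auto intro!: derivative_eq_intros)
    ultimately have "((\<lambda>x. \<bar>sin (real k * pi * x)\<bar>) has_real_derivative
        abs_sin_right_slope (real k * pi * x0) * (real k * pi)) (at x0 within {x0..})"
      using DERIV_image_chain[of "\<lambda>x. \<bar>sin x\<bar>" _ "\<lambda>x. real k * pi * x"] by (simp add: o_def)
    from DERIV_cdivide[OF this, of "real k"] show ?thesis
      using that by (simp add: field_simps)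
  qed
  then have "((\<lambda>x. \<Sum>k=1..n. \<bar>sin (real k * pi * x)\<bar> / real k) has_real_derivative
      (\<Sum>k=1..n. pi * abs_sin_right_slope (real k * pi * x0))) (at x0 within {x0..})"
    by (intro DERIV_sum)
  moreover have "abs_sin_sum n = (\<lambda>x. \<Sum>k=1..n. \<bar>sin (real k * pi * x)\<bar> / real k)"
    by (simp add: fun_eq_iff abs_sin_sum_def)
  ultimately show ?thesis
    by (simp add: sum_distrib_left)
qed

lemma sum_odd_periodic_eq_0:
  fixes g :: "nat \<Rightarrow> real"
  assumes odd: "\<And>k. k \<le> q \<Longrightarrow> g (q - k) = - g k"
    and periodic: "\<And>k. g (k + q) = g k"
  shows "(\<Sum>k<m * q. g k) = 0"
proof -
  have "(\<Sum>k<q. g k) = (\<Sum>k<q. g (q - Suc k))"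
    by (rule sum.nat_diff_reindex[symmetric])
  also have "\<dots> = (\<Sum>k<q. - g (Suc k))"
    by (intro sum.cong) (auto intro: odd)
  \<comment> \<open>The index range 1 to q may be moved back to 0 to q - 1, since
    \<open>g q = g 0\<close>.\<close>
  also have "\<dots> = - (\<Sum>k<q. g k)"
    using sum.lessThan_Suc_shift[of g q] periodic[of 0] by (simp add: sum_negf)
  finally have block: "(\<Sum>k<q. g k) = 0"
    by simp
  have shift: "g (k + j * q) = g k" for k j
  proof (induction j)
    case (Suc j)
    then show ?case
      using periodic[of "k + j * q"] by (simp add: algebra_simps)
  qed simp
  show ?thesis
  proof (induction m)
    case (Suc m)
    have "(\<Sum>k<Suc m * q. g k) = (\<Sum>k<m * q. g k) + (\<Sum>k=m * q..<m * q + q. g k)"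
      by (simp add: add.commute sum.atLeastLessThan_concat flip: atLeast0LessThan)
    also have "(\<Sum>k=m * q..<m * q + q. g k) = (\<Sum>k<q. g (k + m * q))"
      using sum.shift_bounds_nat_ivl[of g 0 "m * q" q]
      by (simp add: add.commute flip: atLeast0LessThan)
    finally show ?case
      using Suc block by (simp add: shift)
  qed simp
qed

lemma sum_right_slope_pos:
  fixes p :: int and q n :: nat
  assumes "q > 0" and "n \<ge> q\<^sup>2"
  shows "(\<Sum>k=1..n. abs_sin_right_slope (real k * pi * (real_of_int p / real q))) > 0"
proof -
  define t where "t k = real k * pi * (real_of_int p / real q)" for k
  \<comment> \<open>This is the slope with value 0 at the zeros of \<open>sin\<close>. Unlike the
    slope itself it is odd under reflection, so it cancels over periods.\<close>
  define g where "g k = cos (t k) * sgn (sin (t k))" for k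
  define m where "m = n div q"
  \<comment> \<open>Here \<open>n \<ge> q\<^sup>2\<close> enters: the gains, at least
    \<open>m\<close>, will exceed the worst loss \<open>n mod q < q\<close>.\<close>
  have "q \<le> m"
    using div_le_mono[OF assms(2), of q] assms(1) by (simp add: m_def power2_eq_square)
  have n: "n = m * q + n mod q" "n mod q < q"
    using assms(1) by (auto simp: m_def)
  have sin_p: "sin (pi * real_of_int p) = 0"
    using sin_zero_iff_int2[of "pi * real_of_int p"] by (auto simp: mult.commute)
  then have cos_p: "cos (pi * real_of_int p) = 1 \<or> cos (pi * real_of_int p) = -1"
    using sin_zero_abs_cos_one[of "pi * real_of_int p"] by linarith
  have sin_0: "sin (t (j * q)) = 0" for j
    using sin_zero_iff_int2[of "t (j * q)"] assms(1)
    by (auto simp: t_def intro!: exI[of _ "int j * p"])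
  have g_odd: "g (q - k) = - g k" if "k \<le> q" for k
  proof -
    \<comment> \<open>With \<open>c = cos (pi * p)\<close>, reflection turns the cosine into
      \<open>c * cos (t k)\<close> and the sine into \<open>- c * sin (t k)\<close>; the claim
      follows from \<open>c * c = 1\<close>.\<close>
    have "t (q - k) = pi * real_of_int p - t k"
      using that assms(1) by (simp add: t_def of_nat_diff field_simps)
    then show ?thesis
      using sin_p cos_p by (auto simp: g_def sin_diff cos_diff sgn_if)
  qed
  have g_periodic: "g (k + q) = g k" for k
  proof -
    have "t (k + q) = t k + pi * real_of_int p"
      using assms(1) by (simp add: t_def field_simps)
    then show ?thesis
      using sin_p cos_p by (auto simp: g_def sin_add cos_add sgn_if)
  qed
  have g_ge: "g k \<ge> -1" for k
    using abs_cos_le_one[of "t k"] by (auto simp: g_def sgn_if abs_le_iff)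
  \<comment> \<open>Only an inequality: if \<open>p\<close> and \<open>q\<close> share a factor,
    \<open>sin (t k)\<close> also vanishes for some \<open>k\<close> not divisible by
    \<open>q\<close>.\<close>
  have slope: "g k + of_bool (q dvd k) \<le> abs_sin_right_slope (t k)" for k
    using sin_0 by (auto simp: abs_sin_right_slope_def g_def elim!: dvdE simp: mult.commute)
  have "card ((\<lambda>j. j * q) ` {1..m}) \<le> card {k\<in>{1..n}. q dvd k}"
    using n(1) assms(1) by (intro card_mono) (auto simp: m_def intro: order_trans[OF mult_le_mono1])
  moreover have "card ((\<lambda>j. j * q) ` {1..m}) = m"
    using assms(1) by (subst card_image) (auto simp: inj_on_def)
  ultimately have multiples: "real m \<le> (\<Sum>k=1..n. of_bool (q dvd k))"
    by (simp add: sum.If_cases of_bool_def Int_def)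
  have "{..n} = {..<m * q} \<union> {m * q..n}"
    using n(1) by auto
  then have "(\<Sum>k\<le>n. g k) = (\<Sum>k<m * q. g k) + (\<Sum>k=m * q..n. g k)"
    by (simp add: sum.union_disjoint[symmetric] ivl_disj_int)
  also have "\<dots> = (\<Sum>k=m * q..n. g k)"
    using sum_odd_periodic_eq_0[of q g m] g_odd g_periodic by simp
  \<comment> \<open>Dropping the zero term at \<open>m * q\<close> leaves \<open>n mod q\<close>
    terms; one more could cost the strict inequality.\<close>
  also have "\<dots> = (\<Sum>k=Suc (m * q)..n. g k)"
    using n(1) sin_0[of m] by (subst sum.atLeast_Suc_atMost) (auto simp: g_def)
  also have "\<dots> \<ge> (\<Sum>k=Suc (m * q)..n. -1)"
    by (intro sum_mono g_ge)
  finally have "(\<Sum>k\<le>n. g k) \<ge> - real (n - m * q)"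
    by simp
  moreover have "n - m * q = n mod q"
    using n(1) by linarith
  moreover have "(\<Sum>k\<le>n. g k) = (\<Sum>k=1..n. g k)"
    using sin_0[of 0] by (simp add: g_def atMost_atLeast0 sum.atLeast_Suc_atMost)
  ultimately have "0 < (\<Sum>k=1..n. g k + of_bool (q dvd k))"
    using multiples n(2) \<open>q \<le> m\<close> by (simp add: sum.distrib)
  also have "\<dots> \<le> (\<Sum>k=1..n. abs_sin_right_slope (t k))"
    by (intro sum_mono slope)
  finally show ?thesis
    by (simp add: t_def)
qed

lemma abs_sin_sum_increases_right:
  fixes p :: int and q n :: nat
  assumes "q > 0" and "n \<ge> q\<^sup>2"
  shows "\<exists>d>0. \<forall>h. 0 < h \<and> h < d \<longrightarrow>
    abs_sin_sum n (real_of_int p / real q) < abs_sin_sum n (real_of_int p / real q + h)"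
proof -
  have "0 < pi * (\<Sum>k=1..n. abs_sin_right_slope (real k * pi * (real_of_int p / real q)))"
    using sum_right_slope_pos[OF assms] by simp
  from has_real_derivative_pos_inc_right[OF has_right_derivative_abs_sin_sum this]
  show ?thesis
    by auto
qed

lemma abs_sin_sum_minus: "abs_sin_sum n (- x) = abs_sin_sum n x"
  by (simp add: abs_sin_sum_def)

theorem mainTheorem1:
  fixes p :: int and q n :: nat
  assumes "q > 0" and "n > 0" and "n \<ge> q\<^sup>2"
  shows "strict_local_min (abs_sin_sum n) (real_of_int p / real q)"
proof -
  define x0 where "x0 = real_of_int p / real q"
  obtain d1 where d1: "d1 > 0"
    "\<And>h. 0 < h \<Longrightarrow> h < d1 \<Longrightarrow> abs_sin_sum n x0 < abs_sin_sum n (x0 + h)"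
    using abs_sin_sum_increases_right[OF assms(1,3), of p] unfolding x0_def by blast
  \<comment> \<open>By evenness, points left of \<open>x0\<close> reflect to points right of
    \<open>- x0\<close>, again a fraction with denominator \<open>q\<close>.\<close>
  obtain d2 where d2: "d2 > 0"
    "\<And>h. 0 < h \<Longrightarrow> h < d2 \<Longrightarrow> abs_sin_sum n (- x0) < abs_sin_sum n (- x0 + h)"
    using abs_sin_sum_increases_right[OF assms(1,3), of "- p"] unfolding x0_def by auto
  have "abs_sin_sum n x0 < abs_sin_sum n x"
    if "0 < \<bar>x - x0\<bar>" "\<bar>x - x0\<bar> < min d1 d2" for x
  proof (cases "x > x0")
    case True
    then show ?thesis
      using d1(2)[of "x - x0"] that by simp
  next
    case False
    then show ?thesis
      using d2(2)[of "x0 - x"] that by (simp add: abs_sin_sum_minus)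
  qed
  then show ?thesis
    unfolding strict_local_min_def x0_def[symmetric]
    using d1(1) d2(1) by (intro exI[of _ "min d1 d2"]) auto
qed

end
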